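(* Let $\mathcal{P}\subseteq\{0,1\}^{\mathbb{N}}$ be a $\Pi^0_1$ class such that $p=\lambda(\mathcal{P})>0$ and $p$ is a computable real. Then every Schnorr random $Z\in\{0,1\}^{\mathbb{N}}$ is multiply recurrent in $\mathcal{P}$, i.e. for every $k\ge1$ there is $n\ge1$ such that $T^{ni}(Z)\in\mathcal{P}$ for all $1\le i\le k$.
   Context: Cantor space $\{0,1\}^{\mathbb{N}}$ carries the uniform (product) measure $\lambda$. $T$ is the shift, deleting the first bit of a sequence. A $\Sigma^0_1$ class is a set of the form $\{Y:\exists\sigma\in S,\ \sigma\prec Y\}$ for a computably enumerable set $S$ of finite binary strings; a $\Pi^0_1$ class is the complement of a $\Sigma^0_1$ class. A Schnorr test is a uniformly computable sequence $(U_m)_{m\in\mathbb{N}}$ of $\Sigma^0_1$ classes with $\lambda(U_m)\le 2^{-m}$ and $\lambda(U_m)$ a computable real uniformly in $m$; $Z$ is Schnorr random if $Z\notin\bigcap_m U_m$ for every Schnorr test. $Z$ is $k$-recurrent in $\mathcal{P}$ if there is $n\ge1$ with $Z\in\bigcap_{1\le i\le k}T^{-ni}(\mathcal{P})$; multiply recurrent if $k$-recurrent for all $k\ge1$. *)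

theory Defs
  imports "HOL-Probability.Probability" "HOL-Library.Nat_Bijection"
begin

text \<open>
  Total recursive functions of arity \<open>n\<close>, as functions on argument lists of length \<open>n\<close>
  (values on lists of any other length are irrelevant). Minimization is restricted to regular
  functions, so only total functions are generated.
\<close>

inductive total_recursive :: "nat \<Rightarrow> (nat list \<Rightarrow> nat) \<Rightarrow> bool" where
  zero: "total_recursive n (\<lambda>xs. 0)"
| succ: "total_recursive 1 (\<lambda>xs. Suc (xs ! 0))"
| proj: "i < n \<Longrightarrow> total_recursive n (\<lambda>xs. xs ! i)"
| comp: "\<lbrakk>total_recursive (length gs) f; \<forall>g\<in>set gs. total_recursive n g\<rbrakk>
    \<Longrightarrow> total_recursive n (\<lambda>xs. f (map (\<lambda>g. g xs) gs))"
| prec: "\<lbrakk>total_recursive n f; total_recursive (Suc (Suc n)) g\<rbrakk>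
    \<Longrightarrow> total_recursive (Suc n)
          (\<lambda>xs. rec_nat (f (tl xs)) (\<lambda>y r. g (y # r # tl xs)) (hd xs))"
| mu: "\<lbrakk>total_recursive (Suc n) f; \<forall>xs. length xs = n \<longrightarrow> (\<exists>y. f (y # xs) = 0)\<rbrakk>
    \<Longrightarrow> total_recursive n (\<lambda>xs. LEAST y. f (y # xs) = 0)"

definition computable :: "(nat \<Rightarrow> nat) \<Rightarrow> bool" where
  "computable f \<longleftrightarrow> (\<exists>g. total_recursive 1 g \<and> (\<forall>x. f x = g [x]))"

definition computable2 :: "(nat \<Rightarrow> nat \<Rightarrow> nat) \<Rightarrow> bool" where
  "computable2 f \<longleftrightarrow> (\<exists>g. total_recursive 2 g \<and> (\<forall>x y. f x y = g [x, y]))"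

definition ce_set :: "nat set \<Rightarrow> bool" where
  "ce_set A \<longleftrightarrow> A = {} \<or> (\<exists>f. computable f \<and> A = range f)"

text \<open>The real is approximated by a computable sequence of rationals \<open>(a - b) / (c + 1)\<close>.\<close>

definition computable_real :: "real \<Rightarrow> bool" where
  "computable_real x \<longleftrightarrow> (\<exists>a b c. computable a \<and> computable b \<and> computable c \<and>
     (\<forall>n. \<bar>x - (real (a n) - real (b n)) / real (Suc (c n))\<bar> \<le> 1 / 2 ^ n))"

definition uniformly_computable_reals :: "(nat \<Rightarrow> real) \<Rightarrow> bool" where
  "uniformly_computable_reals x \<longleftrightarrow>
     (\<exists>a b c. computable2 a \<and> computable2 b \<and> computable2 c \<and>
       (\<forall>m n. \<bar>x m - (real (a m n) - real (b m n)) / real (Suc (c m n))\<bar> \<le> 1 / 2 ^ n))"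

text \<open>
  The length-lexicographic bijection between binary strings and natural numbers: the binary
  expansion of \<open>string_code \<sigma> + 1\<close> is \<open>1\<sigma>\<close>.
\<close>

definition string_code :: "bool list \<Rightarrow> nat" where
  "string_code \<sigma> = foldl (\<lambda>n b. 2 * n + of_bool b) 1 \<sigma> - 1"

definition ce_strings :: "bool list set \<Rightarrow> bool" where
  "ce_strings S \<longleftrightarrow> ce_set (string_code ` S)"

definition uniformly_ce_strings :: "(nat \<Rightarrow> bool list set) \<Rightarrow> bool" where
  "uniformly_ce_strings S \<longleftrightarrow>
     ce_set {prod_encode (m, string_code \<sigma>) | m \<sigma>. \<sigma> \<in> S m}"

type_synonym cantor = "nat \<Rightarrow> bool"

definition cantor_measure :: "cantor measure" where
  "cantor_measure = (\<Pi>\<^sub>M i\<in>UNIV. measure_pmf (bernoulli_pmf (1/2)))"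

definition shift :: "cantor \<Rightarrow> cantor" where
  "shift Y = (\<lambda>i. Y (Suc i))"

definition initial_segment :: "bool list \<Rightarrow> cantor \<Rightarrow> bool" where
  "initial_segment \<sigma> Y \<longleftrightarrow> (\<forall>i < length \<sigma>. Y i = \<sigma> ! i)"

definition open_class :: "bool list set \<Rightarrow> cantor set" where
  "open_class S = {Y. \<exists>\<sigma>\<in>S. initial_segment \<sigma> Y}"

definition Sigma01_class :: "cantor set \<Rightarrow> bool" where
  "Sigma01_class U \<longleftrightarrow> (\<exists>S. ce_strings S \<and> U = open_class S)"

definition Pi01_class :: "cantor set \<Rightarrow> bool" where
  "Pi01_class P \<longleftrightarrow> Sigma01_class (- P)"

definition uniformly_Sigma01 :: "(nat \<Rightarrow> cantor set) \<Rightarrow> bool" where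
  "uniformly_Sigma01 U \<longleftrightarrow> (\<exists>S. uniformly_ce_strings S \<and> (\<forall>m. U m = open_class (S m)))"

definition Schnorr_test :: "(nat \<Rightarrow> cantor set) \<Rightarrow> bool" where
  "Schnorr_test U \<longleftrightarrow> uniformly_Sigma01 U \<and>
     (\<forall>m. measure cantor_measure (U m) \<le> 1 / 2 ^ m) \<and>
     uniformly_computable_reals (\<lambda>m. measure cantor_measure (U m))"

definition Schnorr_random :: "cantor \<Rightarrow> bool" where
  "Schnorr_random Z \<longleftrightarrow> (\<forall>U. Schnorr_test U \<longrightarrow> Z \<notin> (\<Inter>m. U m))"

definition k_recurrent :: "nat \<Rightarrow> cantor set \<Rightarrow> cantor \<Rightarrow> bool" where
  "k_recurrent k P Z \<longleftrightarrow> (\<exists>n\<ge>1. Z \<in> (\<Inter>i\<in>{1..k}. (shift ^^ (n * i)) -` P))"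

definition multiply_recurrent :: "cantor set \<Rightarrow> cantor \<Rightarrow> bool" where
  "multiply_recurrent P Z \<longleftrightarrow> (\<forall>k\<ge>1. k_recurrent k P Z)"

end

theory Submission
  imports Defs
begin

text \<open>
  Let \<open>U\<close> be the complement of \<open>P\<close>. A point that is not \<open>k\<close>-recurrent in \<open>P\<close> lies, for every \<open>n\<close>, in
  \<open>V n\<close>, the union over \<open>1 \<le> i \<le> k\<close> of the preimages of \<open>U\<close> under the \<open>n i\<close>-th power of the shift. Since
  the measure of \<open>U\<close> is computable, one can compute clopen sets \<open>U' \<subseteq> U\<close> with \<open>U - U'\<close> as small as
  desired. If \<open>U'\<close> depends on \<open>L\<close> bits only and \<open>n\<^sub>j = N (k + 1)^j\<close> with \<open>N > L\<close>, then the blocks of bits that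
  decide whether the shift by \<open>n\<^sub>j i\<close> lands in \<open>U'\<close> are pairwise disjoint. By independence the
  intersection of the \<open>V n\<^sub>j\<close> for \<open>j < t\<close>, taken for \<open>U'\<close>, has measure at most \<open>(1 - p^k)^t\<close>, and
  replacing \<open>U'\<close> by \<open>U\<close> adds at most \<open>t k\<close> times the measure of \<open>U - U'\<close>. Letting \<open>t\<close> grow linearly in
  \<open>m\<close> gives a Schnorr test; the measures are computable because they are approximated by those of
  clopen sets.
\<close>

subsection \<open>Closure properties of the recursive functions\<close>

text \<open>Arguments are read off through \<open>hd\<close> and \<open>tl\<close>, a bound variable being the head of the extended
  list: in this form the closure rules are higher-order patterns, so that recursiveness of an
  expression follows by \<open>intro recursive_intros\<close>.\<close>

definition recursive_fun :: "nat \<Rightarrow> (nat list \<Rightarrow> nat) \<Rightarrow> bool" where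
  "recursive_fun n f \<longleftrightarrow> (\<exists>g. total_recursive n g \<and> (\<forall>xs. length xs = n \<longrightarrow> f xs = g xs))"

definition recursive_pred :: "nat \<Rightarrow> (nat list \<Rightarrow> bool) \<Rightarrow> bool" where
  "recursive_pred n Q \<longleftrightarrow> recursive_fun n (\<lambda>xs. of_bool (Q xs))"

section \<open>Substitution and primitive recursion\<close>

lemma recursive_fun_cong:
  assumes "recursive_fun n f" "\<And>xs. length xs = n \<Longrightarrow> g xs = f xs"
  shows "recursive_fun n g"
  using assms unfolding recursive_fun_def by metis

lemma recursive_fun_comp:
  assumes "recursive_fun (length gs) f" "\<And>g. g \<in> set gs \<Longrightarrow> recursive_fun n g"
  shows "recursive_fun n (\<lambda>xs. f (map (\<lambda>g. g xs) gs))"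
proof -
  obtain f' where f': "total_recursive (length gs) f'" "\<And>xs. length xs = length gs \<Longrightarrow> f xs = f' xs"
    using assms(1) by (auto simp: recursive_fun_def)
  have "\<forall>g\<in>set gs. \<exists>g'. total_recursive n g' \<and> (\<forall>xs. length xs = n \<longrightarrow> g xs = g' xs)"
    using assms(2) by (auto simp: recursive_fun_def)
  then obtain H where H: "\<And>g. g \<in> set gs \<Longrightarrow> total_recursive n (H g)"
    "\<And>g xs. g \<in> set gs \<Longrightarrow> length xs = n \<Longrightarrow> g xs = H g xs"
    by metis
  have "total_recursive n (\<lambda>xs. f' (map (\<lambda>g. g xs) (map H gs)))"
    using f'(1) H(1) by (intro total_recursive.comp) auto
  moreover have "f (map (\<lambda>g. g xs) gs) = f' (map (\<lambda>g. g xs) (map H gs))" if "length xs = n" for xs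
  proof -
    have "map (\<lambda>g. g xs) gs = map (\<lambda>g. g xs) (map H gs)"
      using H(2) that by simp
    then show ?thesis using f'(2)[of "map (\<lambda>g. g xs) gs"] by (simp only: length_map)
  qed
  ultimately show ?thesis unfolding recursive_fun_def by blast
qed

lemma recursive_fun_nth: "i < n \<Longrightarrow> recursive_fun n (\<lambda>xs. xs ! i)"
  unfolding recursive_fun_def by (blast intro: total_recursive.proj)

lemma recursive_fun_comp1:
  assumes "recursive_fun 1 f" "recursive_fun n g"
  shows "recursive_fun n (\<lambda>xs. f [g xs])"
  using recursive_fun_comp[of "[g]" f n] assms by simp

lemma recursive_fun_comp2:
  assumes "recursive_fun 2 (\<lambda>xs. f (hd xs) (hd (tl xs)))" "recursive_fun n g" "recursive_fun n h"
  shows "recursive_fun n (\<lambda>xs. f (g xs) (h xs))"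
  using recursive_fun_comp[of "[g, h]" "\<lambda>xs. f (hd xs) (hd (tl xs))" n] assms
  by (auto simp: numeral_2_eq_2)

lemma recursive_pred_comp3:
  assumes "recursive_pred 3 (\<lambda>xs. Q (hd xs) (hd (tl xs)) (hd (tl (tl xs))))"
    and "recursive_fun n f" "recursive_fun n g" "recursive_fun n h"
  shows "recursive_pred n (\<lambda>xs. Q (f xs) (g xs) (h xs))"
  using recursive_fun_comp[of "[f, g, h]"
      "\<lambda>xs. of_bool (Q (hd xs) (hd (tl xs)) (hd (tl (tl xs))))" n] assms
  unfolding recursive_pred_def by (auto simp: numeral_3_eq_3)

lemma recursive_fun_Suc:
  assumes "recursive_fun n f"
  shows "recursive_fun n (\<lambda>xs. Suc (f xs))"
proof -
  have "recursive_fun 1 (\<lambda>xs. Suc (xs ! 0))"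
    unfolding recursive_fun_def by (blast intro: total_recursive.succ)
  from recursive_fun_comp1[OF this assms] show ?thesis by simp
qed

lemma recursive_fun_const: "recursive_fun n (\<lambda>xs. c)"
proof (induction c)
  case 0
  show ?case unfolding recursive_fun_def by (blast intro: total_recursive.zero)
qed (rule recursive_fun_Suc)

text \<open>Weakening: dropping the head composes \<open>f\<close> with the projections 1 to
  \<open>n\<close>. It lets parameters be used beneath a bound variable.\<close>

lemma recursive_fun_tl:
  assumes "recursive_fun n f"
  shows "recursive_fun (Suc n) (\<lambda>xs. f (tl xs))"
proof -
  let ?gs = "map (\<lambda>i xs. xs ! Suc i) [0..<n]"
  have "recursive_fun (Suc n) (\<lambda>xs. f (map (\<lambda>g. g xs) ?gs))"
    using assms by (intro recursive_fun_comp) (auto intro: recursive_fun_nth)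
  then show ?thesis
  proof (rule recursive_fun_cong)
    fix xs :: "nat list" assume "length xs = Suc n"
    then have "map (\<lambda>g. g xs) ?gs = tl xs"
      by (intro nth_equalityI) (auto simp: nth_tl)
    then show "f (tl xs) = f (map (\<lambda>g. g xs) ?gs)" by simp
  qed
qed

lemma recursive_fun_hd: "recursive_fun (Suc n) (\<lambda>xs. hd xs)"
  by (rule recursive_fun_cong[OF recursive_fun_nth[of 0]]) (auto simp: hd_conv_nth length_Suc_conv)

lemmas recursive_fun_vars =
  recursive_fun_hd
  recursive_fun_hd[THEN recursive_fun_tl]
  recursive_fun_hd[THEN recursive_fun_tl, THEN recursive_fun_tl]
  recursive_fun_hd[THEN recursive_fun_tl, THEN recursive_fun_tl, THEN recursive_fun_tl]
  recursive_fun_hd[THEN recursive_fun_tl, THEN recursive_fun_tl, THEN recursive_fun_tl,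
    THEN recursive_fun_tl]

lemma recursive_fun_Cons:
  assumes "recursive_fun (Suc n) f" "recursive_fun n b"
  shows "recursive_fun n (\<lambda>xs. f (b xs # xs))"
proof -
  let ?gs = "b # map (\<lambda>i xs. xs ! i) [0..<n]"
  have "recursive_fun n (\<lambda>xs. f (map (\<lambda>g. g xs) ?gs))"
    using assms by (intro recursive_fun_comp) (auto intro: recursive_fun_nth)
  then show ?thesis
  proof (rule recursive_fun_cong)
    fix xs :: "nat list" assume "length xs = n"
    then have "map (\<lambda>g. g xs) ?gs = b xs # xs"
      by (auto intro: nth_equalityI)
    then show "f (b xs # xs) = f (map (\<lambda>g. g xs) ?gs)" by simp
  qed
qed

text \<open>The \<open>prec\<close> schema recurses on the head of its argument list; substituting
  \<open>b xs\<close> for that head through \<open>recursive_fun_Cons\<close> gives recursion up to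
  any recursive bound, with \<open>xs\<close> as parameters.\<close>

lemma recursive_fun_rec_nat:
  assumes "recursive_fun n b" "recursive_fun n f"
    and "recursive_fun (Suc (Suc n)) (\<lambda>xs. g (tl (tl xs)) (hd xs) (hd (tl xs)))"
  shows "recursive_fun n (\<lambda>xs. rec_nat (f xs) (g xs) (b xs))"
proof -
  obtain f' where f': "total_recursive n f'" "\<And>xs. length xs = n \<Longrightarrow> f xs = f' xs"
    using assms(2) by (auto simp: recursive_fun_def)
  obtain g' where g': "total_recursive (Suc (Suc n)) g'"
    "\<And>xs. length xs = Suc (Suc n) \<Longrightarrow> g (tl (tl xs)) (hd xs) (hd (tl xs)) = g' xs"
    using assms(3) by (auto simp: recursive_fun_def)
  let ?R = "\<lambda>xs. rec_nat (f' (tl xs)) (\<lambda>y r. g' (y # r # tl xs)) (hd xs)"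
  have "recursive_fun (Suc n) ?R"
    unfolding recursive_fun_def using total_recursive.prec[OF f'(1) g'(1)] by blast
  then have "recursive_fun n (\<lambda>xs. ?R (b xs # xs))"
    using assms(1) by (rule recursive_fun_Cons)
  then show ?thesis
  proof (rule recursive_fun_cong)
    fix xs :: "nat list" assume xs: "length xs = n"
    have "g xs = (\<lambda>y r. g' (y # r # xs))"
      using g'(2)[of "_ # _ # xs"] xs by (auto simp: fun_eq_iff)
    then show "rec_nat (f xs) (g xs) (b xs) = ?R (b xs # xs)"
      using f'(2)[OF xs] by simp
  qed
qed

section \<open>Arithmetic functions\<close>

lemma recursive_fun_add:
  assumes "recursive_fun n f" "recursive_fun n g"
  shows "recursive_fun n (\<lambda>xs. f xs + g xs)"
proof -
  have "recursive_fun n (\<lambda>xs. rec_nat (f xs) (\<lambda>_ r. Suc r) (g xs))"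
    by (intro recursive_fun_rec_nat recursive_fun_Suc recursive_fun_vars assms)
  moreover have "rec_nat a (\<lambda>_ r. Suc r) b = a + b" for a b
    by (induction b) auto
  ultimately show ?thesis by simp
qed

lemma recursive_fun_mult:
  assumes "recursive_fun n f" "recursive_fun n g"
  shows "recursive_fun n (\<lambda>xs. f xs * g xs)"
proof -
  have "recursive_fun n (\<lambda>xs. rec_nat 0 (\<lambda>_ r. r + f xs) (g xs))"
    by (intro recursive_fun_rec_nat recursive_fun_add recursive_fun_const recursive_fun_vars assms
        recursive_fun_tl)
  moreover have "rec_nat 0 (\<lambda>_ r. r + a) b = a * b" for a b :: nat
    by (induction b) auto
  ultimately show ?thesis by simp
qed

lemma recursive_fun_power:
  assumes "recursive_fun n f" "recursive_fun n g"
  shows "recursive_fun n (\<lambda>xs. f xs ^ g xs)"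
proof -
  have "recursive_fun n (\<lambda>xs. rec_nat 1 (\<lambda>_ r. r * f xs) (g xs))"
    by (intro recursive_fun_rec_nat recursive_fun_mult recursive_fun_const recursive_fun_vars assms
        recursive_fun_tl)
  moreover have "rec_nat 1 (\<lambda>_ r. r * a) b = a ^ b" for a b :: nat
    by (induction b) auto
  ultimately show ?thesis by simp
qed

lemma recursive_fun_diff:
  assumes "recursive_fun n f" "recursive_fun n g"
  shows "recursive_fun n (\<lambda>xs. f xs - g xs)"
proof -
  have pred: "recursive_fun m (\<lambda>xs. h xs - 1)" if "recursive_fun m h" for m h
  proof -
    have "recursive_fun m (\<lambda>xs. rec_nat 0 (\<lambda>y _. y) (h xs))"
      by (intro recursive_fun_rec_nat recursive_fun_const recursive_fun_vars that)
    moreover have "rec_nat 0 (\<lambda>y _. y) a = a - 1" for a :: nat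
      by (cases a) auto
    ultimately show ?thesis by simp
  qed
  have "recursive_fun n (\<lambda>xs. rec_nat (f xs) (\<lambda>_ r. r - 1) (g xs))"
    by (intro recursive_fun_rec_nat pred recursive_fun_vars assms)
  moreover have "rec_nat a (\<lambda>_ r. r - 1) b = a - b" for a b :: nat
    by (induction b) auto
  ultimately show ?thesis by simp
qed

lemma recursive_fun_sum:
  assumes "recursive_fun n b" "recursive_fun (Suc n) (\<lambda>xs. f (tl xs) (hd xs))"
  shows "recursive_fun n (\<lambda>xs. \<Sum>i<b xs. f xs i)"
proof -
  \<comment> \<open>Inside the recursion the list holds counter, accumulator and parameters; the
    summand ignores the accumulator, hence projections that skip position 1.\<close>
  have "recursive_fun (Suc (Suc n)) (\<lambda>xs. f (tl (tl xs)) (hd xs))"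
  proof -
    let ?h = "\<lambda>xs. f (tl xs) (hd xs)"
    let ?gs = "(\<lambda>xs. hd xs) # map (\<lambda>i xs. xs ! Suc (Suc i)) [0..<n]"
    have "recursive_fun (Suc (Suc n)) (\<lambda>xs. ?h (map (\<lambda>g. g xs) ?gs))"
      using assms(2) by (intro recursive_fun_comp) (auto intro: recursive_fun_nth recursive_fun_hd)
    then show ?thesis
    proof (rule recursive_fun_cong)
      fix xs :: "nat list" assume "length xs = Suc (Suc n)"
      then have "map (\<lambda>g. g xs) ?gs = hd xs # tl (tl xs)"
        by (auto intro!: nth_equalityI simp: nth_tl)
      then show "f (tl (tl xs)) (hd xs) = ?h (map (\<lambda>g. g xs) ?gs)"
        by simp
    qed
  qed
  then have "recursive_fun n (\<lambda>xs. rec_nat 0 (\<lambda>i r. r + f xs i) (b xs))"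
    by (intro recursive_fun_rec_nat recursive_fun_add recursive_fun_const recursive_fun_vars assms)
  moreover have "rec_nat 0 (\<lambda>i r. r + h i) m = (\<Sum>i<m. h i)" for h :: "nat \<Rightarrow> nat" and m
    by (induction m) auto
  ultimately show ?thesis by simp
qed

section \<open>Decidable predicates and bounded quantifiers\<close>

lemma recursive_fun_of_bool:
  "recursive_pred n Q \<Longrightarrow> recursive_fun n (\<lambda>xs. of_bool (Q xs))"
  by (simp add: recursive_pred_def)

lemma recursive_pred_le:
  assumes "recursive_fun n f" "recursive_fun n g"
  shows "recursive_pred n (\<lambda>xs. f xs \<le> g xs)"
proof -
  have "recursive_fun n (\<lambda>xs. 1 - (f xs - g xs))"
    by (intro recursive_fun_diff recursive_fun_const assms)
  then show ?thesis
    unfolding recursive_pred_def by (rule recursive_fun_cong) auto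
qed

lemma recursive_pred_less:
  assumes "recursive_fun n f" "recursive_fun n g"
  shows "recursive_pred n (\<lambda>xs. f xs < g xs)"
  using recursive_pred_le[OF recursive_fun_Suc[OF assms(1)] assms(2)] by (simp add: Suc_le_eq)

lemma recursive_pred_conj:
  assumes "recursive_pred n Q" "recursive_pred n R"
  shows "recursive_pred n (\<lambda>xs. Q xs \<and> R xs)"
  using recursive_fun_mult assms by (simp add: recursive_pred_def of_bool_conj)

lemma recursive_pred_not:
  assumes "recursive_pred n Q"
  shows "recursive_pred n (\<lambda>xs. \<not> Q xs)"
  using recursive_fun_diff[OF recursive_fun_const[of n 1] assms[unfolded recursive_pred_def]]
  unfolding recursive_pred_def by (rule recursive_fun_cong) auto

lemma recursive_pred_eq:
  assumes "recursive_fun n f" "recursive_fun n g"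
  shows "recursive_pred n (\<lambda>xs. f xs = g xs)"
  using recursive_pred_conj[OF recursive_pred_le[OF assms] recursive_pred_le[OF assms(2,1)]]
  by (simp add: eq_iff)

lemma recursive_pred_bex:
  assumes "recursive_fun n b" "recursive_pred (Suc n) (\<lambda>xs. Q (tl xs) (hd xs))"
  shows "recursive_pred n (\<lambda>xs. \<exists>i<b xs. Q xs i)"
proof -
  have "recursive_pred n (\<lambda>xs. 0 < (\<Sum>i<b xs. of_bool (Q xs i) :: nat))"
    using assms(2) unfolding recursive_pred_def
    by (intro recursive_pred_less[unfolded recursive_pred_def] recursive_fun_const
        recursive_fun_sum assms(1))
  moreover have "0 < (\<Sum>i<m. of_bool (R i) :: nat) \<longleftrightarrow> (\<exists>i<m. R i)" for m :: nat and R
    by (auto simp: sum_nonneg_eq_0_iff zero_less_iff_neq_zero)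
  ultimately show ?thesis by simp
qed

lemma recursive_pred_ball:
  assumes "recursive_fun n b" "recursive_pred (Suc n) (\<lambda>xs. Q (tl xs) (hd xs))"
  shows "recursive_pred n (\<lambda>xs. \<forall>i<b xs. Q xs i)"
  using recursive_pred_not[OF recursive_pred_bex[OF assms(1) recursive_pred_not[OF assms(2)]]]
  by simp

lemma recursive_fun_div:
  assumes "recursive_fun n f" "recursive_fun n g"
  shows "recursive_fun n (\<lambda>xs. f xs div g xs)"
proof -
  \<comment> \<open>The quotient counts the positive multiples of the divisor up to the dividend.
    The conjunct \<open>0 < g xs\<close> yields 0 for divisor 0, in agreement with
    \<open>div\<close>.\<close>
  have "recursive_fun n (\<lambda>xs. \<Sum>i<f xs. of_bool (Suc i * g xs \<le> f xs \<and> 0 < g xs))"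
    by (intro recursive_fun_sum recursive_fun_of_bool recursive_pred_conj recursive_pred_le
        recursive_pred_less recursive_fun_mult recursive_fun_Suc recursive_fun_vars
        recursive_fun_const assms recursive_fun_tl)
  moreover have "(\<Sum>i<a. of_bool (Suc i * b \<le> a \<and> 0 < b) :: nat) = a div b" for a b :: nat
  proof (cases "b = 0")
    case False
    have "Suc i * b \<le> a \<longleftrightarrow> i < a div b" for i
      using False less_eq_div_iff_mult_less_eq[of b "Suc i" a] by (simp add: Suc_le_eq)
    then have "(\<Sum>i<a. of_bool (Suc i * b \<le> a \<and> 0 < b)) = (\<Sum>i<a. of_bool (i < a div b) :: nat)"
      using False by (simp del: mult_Suc)
    also have "\<dots> = (\<Sum>i<a div b. 1)"
      by (intro sum.mono_neutral_cong_right) (auto intro: less_le_trans)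
    finally show ?thesis by simp
  qed simp
  ultimately show ?thesis by simp
qed

lemma recursive_fun_mod:
  assumes "recursive_fun n f" "recursive_fun n g"
  shows "recursive_fun n (\<lambda>xs. f xs mod g xs)"
  using recursive_fun_diff[OF assms(1) recursive_fun_mult[OF recursive_fun_div[OF assms] assms(2)]]
  by (simp add: minus_div_mult_eq_mod)

lemma recursive_fun_if:
  assumes "recursive_pred n Q" "recursive_fun n f" "recursive_fun n g"
  shows "recursive_fun n (\<lambda>xs. if Q xs then f xs else g xs)"
proof -
  have "recursive_fun n (\<lambda>xs. of_bool (Q xs) * f xs + of_bool (\<not> Q xs) * g xs)"
    by (intro recursive_fun_add recursive_fun_mult recursive_fun_of_bool recursive_pred_not assms)
  then show ?thesis by (rule recursive_fun_cong) auto
qed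

text \<open>The \<open>mu\<close> clause searches for a zero, so it is applied to the indicator of
  the negated predicate.\<close>

lemma recursive_fun_Least:
  assumes "recursive_pred (Suc n) (\<lambda>xs. Q (tl xs) (hd xs))" "\<And>xs. \<exists>y. Q xs y"
  shows "recursive_fun n (\<lambda>xs. LEAST y. Q xs y)"
proof -
  have "recursive_fun (Suc n) (\<lambda>xs. of_bool (\<not> Q (tl xs) (hd xs)))"
    by (intro recursive_fun_of_bool recursive_pred_not assms)
  then obtain f where f: "total_recursive (Suc n) f"
    "\<And>xs. length xs = Suc n \<Longrightarrow> of_bool (\<not> Q (tl xs) (hd xs)) = f xs"
    by (auto simp: recursive_fun_def)
  have eq: "f (y # xs) = 0 \<longleftrightarrow> Q xs y" if "length xs = n" for xs y
    using f(2)[of "y # xs"] that by (auto simp: of_bool_def split: if_splits)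
  have "total_recursive n (\<lambda>xs. LEAST y. f (y # xs) = 0)"
    using assms(2) eq by (intro total_recursive.mu f(1)) auto
  then show ?thesis
    unfolding recursive_fun_def by (intro exI conjI) (auto simp: eq)
qed

lemma recursive_fun_computable:
  assumes "computable f" "recursive_fun n g"
  shows "recursive_fun n (\<lambda>xs. f (g xs))"
proof -
  obtain f' where "total_recursive 1 f'" "\<forall>x. f x = f' [x]"
    using assms(1) by (auto simp: computable_def)
  moreover from this have "recursive_fun 1 f'" by (auto simp: recursive_fun_def)
  ultimately show ?thesis using recursive_fun_comp1[of f' n g] assms(2) by simp
qed

lemma computableI:
  assumes "recursive_fun 1 (\<lambda>xs. f (hd xs))"
  shows "computable f"
proof -
  obtain g where "total_recursive 1 g" "\<And>xs. length xs = 1 \<Longrightarrow> f (hd xs) = g xs"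
    using assms by (auto simp: recursive_fun_def)
  moreover from this(2)[of "[_]"] have "f x = g [x]" for x by simp
  ultimately show ?thesis unfolding computable_def by blast
qed

lemma computable2I:
  assumes "recursive_fun 2 (\<lambda>xs. f (hd xs) (hd (tl xs)))"
  shows "computable2 f"
proof -
  obtain g where g: "total_recursive 2 g" "\<And>xs. length xs = 2 \<Longrightarrow> f (hd xs) (hd (tl xs)) = g xs"
    using assms by (auto simp: recursive_fun_def)
  have "f x y = g [x, y]" for x y using g(2)[of "[x, y]"] by simp
  with g(1) show ?thesis unfolding computable2_def by blast
qed

lemmas recursive_intros =
  recursive_fun_vars recursive_fun_const recursive_fun_Suc recursive_fun_add recursive_fun_mult
  recursive_fun_power recursive_fun_diff recursive_fun_sum recursive_fun_div recursive_fun_mod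
  recursive_fun_if recursive_fun_of_bool recursive_pred_le recursive_pred_less recursive_pred_eq
  recursive_pred_conj recursive_pred_not recursive_pred_bex recursive_pred_ball

section \<open>Pairing and computably enumerable sets\<close>

lemma recursive_fun_prod_encode:
  assumes "recursive_fun n f" "recursive_fun n g"
  shows "recursive_fun n (\<lambda>xs. prod_encode (f xs, g xs))"
proof -
  have "recursive_fun n (\<lambda>xs. (f xs + g xs) * Suc (f xs + g xs) div 2 + f xs)"
    by (intro recursive_intros assms)
  then show ?thesis by (simp add: prod_encode_def triangle_def)
qed

text \<open>The components of a pair are at most its code, so each is found by a search in which the
  other component is bounded by the code.\<close>

lemma computable_fst_prod_decode: "computable (\<lambda>z. fst (prod_decode z))"
  and computable_snd_prod_decode: "computable (\<lambda>z. snd (prod_decode z))"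
proof -
  have ex: "\<exists>x y. x < Suc z \<and> y < Suc z \<and> prod_encode (x, y) = z" for z
    using le_prod_encode_1 le_prod_encode_2
    by (metis prod_decode_inverse surj_pair less_Suc_eq_le)
  have "fst (prod_decode z) = (LEAST x. \<exists>y<Suc z. prod_encode (x, y) = z)"
    and "snd (prod_decode z) = (LEAST y. \<exists>x<Suc z. prod_encode (x, y) = z)" for z
    using ex[of z] by (auto intro!: Least_equality[symmetric])
  moreover have "recursive_fun 1 (\<lambda>xs. LEAST x. \<exists>y<Suc (hd xs). prod_encode (x, y) = hd xs)"
    "recursive_fun 1 (\<lambda>xs. LEAST y. \<exists>x<Suc (hd xs). prod_encode (x, y) = hd xs)"
    using ex by (auto intro!: recursive_fun_Least recursive_intros recursive_fun_prod_encode) blast+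
  ultimately show "computable (\<lambda>z. fst (prod_decode z))" "computable (\<lambda>z. snd (prod_decode z))"
    by (auto intro: computableI)
qed

text \<open>Run through all pairs of a candidate and a possible witness; output the candidate if
  \<open>Q\<close> accepts the witness and a fixed member \<open>c\<close> otherwise, so that the
  enumeration is total.\<close>

lemma ce_set_projection:
  assumes "recursive_pred 3 (\<lambda>xs. Q (hd xs) (hd (tl xs)) (hd (tl (tl xs))))"
  shows "ce_set {prod_encode (m, y) | m y. \<exists>r. Q m y r}" (is "ce_set ?A")
proof (cases "?A = {}")
  case False
  then obtain c where c: "c \<in> ?A" by blast
  define g where "g z = (let u = fst (prod_decode z) in
     if Q (fst (prod_decode u)) (snd (prod_decode u)) (snd (prod_decode z)) then u else c)" for z
  have "?A = range g"
  proof (intro equalityI subsetI)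
    fix x assume "x \<in> ?A"
    then obtain m y r where "x = prod_encode (m, y)" "Q m y r" by blast
    then have "g (prod_encode (x, r)) = x" by (simp add: g_def)
    then show "x \<in> range g" by (metis rangeI)
  next
    fix x assume "x \<in> range g"
    then obtain z where z: "x = g z" by blast
    show "x \<in> ?A"
    proof (cases "x = c")
      case False
      with z show ?thesis
        by (auto simp: g_def Let_def split: if_splits) (metis prod.collapse prod_decode_inverse)
    qed (use c in simp)
  qed
  moreover have "computable g"
  proof (rule computableI)
    show "recursive_fun 1 (\<lambda>xs. g (hd xs))"
      unfolding g_def Let_def One_nat_def
      by (intro recursive_intros recursive_pred_comp3[OF assms]
          recursive_fun_computable[OF computable_fst_prod_decode]
          recursive_fun_computable[OF computable_snd_prod_decode])
  qed
  ultimately show ?thesis unfolding ce_set_def by blast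
qed (simp add: ce_set_def)

subsection \<open>Cylinders and the shift in Cantor space\<close>

interpretation cantor: prob_space cantor_measure
  unfolding cantor_measure_def by (intro prob_space_PiM prob_space_measure_pmf)

lemma space_cantor [simp]: "space cantor_measure = UNIV"
  by (simp add: cantor_measure_def space_PiM PiE_UNIV_domain)

lemma measurable_cantor_component [measurable]:
  "(\<lambda>Y. Y i) \<in> measurable cantor_measure (count_space UNIV)"
  using measurable_component_singleton[of i UNIV "\<lambda>_. measure_pmf (bernoulli_pmf (1/2))"]
  by (simp add: cantor_measure_def)

section \<open>The shift preserves the measure\<close>

lemma shift_funpow: "(shift ^^ n) Y = (\<lambda>i. Y (n + i))"
  by (induction n) (auto simp: shift_def)

lemma measurable_shift_funpow [measurable]:
  "(shift ^^ n) \<in> measurable cantor_measure cantor_measure"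
proof -
  have "(\<lambda>Y. (shift ^^ n) Y i) \<in> measurable cantor_measure (measure_pmf (bernoulli_pmf (1/2)))" for i
    by (simp add: shift_funpow measurable_cantor_component)
  then show ?thesis
    by (subst (2) cantor_measure_def, intro measurable_PiM_single') (auto simp: PiE_UNIV_domain)
qed

lemma sets_shift_vimage:
  "A \<in> sets cantor_measure \<Longrightarrow> (shift ^^ n) -` A \<in> sets cantor_measure"
  using measurable_sets[OF measurable_shift_funpow, of A n] by simp

text \<open>A power of the shift reindexes coordinates along the injection
  \<open>i \<mapsto> n + i\<close>, and injective reindexing of a product of identical factors gives
  the same product.\<close>

lemma measure_shift_vimage:
  assumes "A \<in> sets cantor_measure"
  shows "measure cantor_measure ((shift ^^ n) -` A) = measure cantor_measure A"
proof -
  have "distr cantor_measure cantor_measure (shift ^^ n) = cantor_measure"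
    using distr_PiM_reindex[of UNIV "\<lambda>_. measure_pmf (bernoulli_pmf (1/2))" "\<lambda>i. n + i" UNIV]
    by (simp add: cantor_measure_def shift_funpow[abs_def] prob_space_measure_pmf
        restrict_def)
  then show ?thesis
    using measure_distr[OF measurable_shift_funpow assms, of n] by simp
qed

text \<open>The binary expansion of \<open>prefix_num Y l\<close> is a leading 1 followed by the first \<open>l\<close> bits of
  \<open>Y\<close>, so that it equals \<open>string_code \<sigma> + 1\<close> for the prefix \<open>\<sigma>\<close> of length \<open>l\<close>.\<close>

primrec prefix_num :: "cantor \<Rightarrow> nat \<Rightarrow> nat" where
  "prefix_num Y 0 = 1"
| "prefix_num Y (Suc l) = 2 * prefix_num Y l + of_bool (Y l)"

lemma prefix_num_ge: "2 ^ l \<le> prefix_num Y l"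
  by (induction l) auto

lemma prefix_num_less: "prefix_num Y l < 2 * 2 ^ l"
  by (induction l) auto

lemma prefix_num_div: "prefix_num Y (l + d) div 2 ^ d = prefix_num Y l"
proof (induction d)
  case (Suc d)
  have "prefix_num Y (l + Suc d) div 2 ^ Suc d = prefix_num Y (l + Suc d) div 2 div 2 ^ d"
    by (simp add: div_mult2_eq)
  also have "prefix_num Y (l + Suc d) div 2 = prefix_num Y (l + d)"
    by simp
  finally show ?case using Suc.IH by simp
qed simp

text \<open>Reduction modulo \<open>2 ^ l\<close> keeps the last \<open>l\<close> of the first
  \<open>q + l\<close> bits; adding \<open>2 ^ l\<close> restores the leading 1.\<close>

lemma prefix_num_shift: "prefix_num ((shift ^^ q) Y) l = 2 ^ l + prefix_num Y (q + l) mod 2 ^ l"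
proof (induction l)
  case (Suc l)
  have "(2 * v + of_bool b) mod (2 * 2 ^ l) = 2 * (v mod 2 ^ l) + of_bool b" for v :: nat and b
    by (cases b) (simp_all add: mod_mult2_eq)
  then show ?case using Suc.IH by (simp add: shift_funpow)
qed simp

lemma prefix_num_cong: "(\<And>i. i < l \<Longrightarrow> Y i = Y' i) \<Longrightarrow> prefix_num Y l = prefix_num Y' l"
  by (induction l) auto

lemma measurable_prefix_num [measurable]:
  "(\<lambda>Y. prefix_num Y l) \<in> measurable cantor_measure (count_space UNIV)"
  by (induction l) simp_all

text \<open>The bounds say that \<open>v\<close> is a leading 1 followed by \<open>l\<close> binary
  digits. The parity of \<open>v\<close> prescribes the last bit and \<open>v div 2\<close> the bits
  before it.\<close>

lemma prefix_num_eq_cylinder: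
  assumes "2 ^ l \<le> v" "v < 2 * 2 ^ l"
  shows "\<exists>\<tau>. \<forall>Y. prefix_num Y l = v \<longleftrightarrow> (\<forall>i<l. Y i = \<tau> i)"
  using assms
proof (induction l arbitrary: v)
  case (Suc l)
  have "2 ^ l \<le> v div 2" "v div 2 < 2 * 2 ^ l" using Suc.prems by auto
  from Suc.IH[OF this] obtain \<tau> where \<tau>: "\<And>Y. prefix_num Y l = v div 2 \<longleftrightarrow> (\<forall>i<l. Y i = \<tau> i)"
    by blast
  have "prefix_num Y (Suc l) = v \<longleftrightarrow> (\<forall>i<Suc l. Y i = (\<tau>(l := odd v)) i)" for Y
  proof -
    have "prefix_num Y (Suc l) = v \<longleftrightarrow> prefix_num Y l = v div 2 \<and> Y l = odd v"
      by (cases "Y l") (auto elim: evenE oddE)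
    also have "\<dots> \<longleftrightarrow> (\<forall>i<Suc l. Y i = (\<tau>(l := odd v)) i)"
      using \<tau> by (auto simp: less_Suc_eq)
    finally show ?thesis .
  qed
  then show ?case by blast
qed simp

section \<open>Measures of clopen sets\<close>

lemma measure_cylinder: "measure cantor_measure {Y. \<forall>i<l. Y i = \<tau> i} = 1 / 2 ^ l"
proof -
  let ?b = "measure_pmf (bernoulli_pmf (1/2))"
  have "{Y. \<forall>i<l. Y i = \<tau> i} = prod_emb UNIV (\<lambda>_. ?b) {..<l} (PiE {..<l} (\<lambda>i. {\<tau> i}))"
  proof (rule set_eqI)
    fix Y
    have "Y \<in> prod_emb UNIV (\<lambda>_. ?b) {..<l} (PiE {..<l} (\<lambda>i. {\<tau> i})) \<longleftrightarrow>
        restrict Y {..<l} \<in> PiE {..<l} (\<lambda>i. {\<tau> i})"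
      by (subst prod_emb_def) simp
    also have "\<dots> \<longleftrightarrow> Y \<in> {Y. \<forall>i<l. Y i = \<tau> i}"
      unfolding PiE_iff by auto
    finally show "Y \<in> {Y. \<forall>i<l. Y i = \<tau> i} \<longleftrightarrow>
        Y \<in> prod_emb UNIV (\<lambda>_. ?b) {..<l} (PiE {..<l} (\<lambda>i. {\<tau> i}))" ..
  qed
  then have "emeasure cantor_measure {Y. \<forall>i<l. Y i = \<tau> i} = (\<Prod>i<l. emeasure ?b {\<tau> i})"
    unfolding cantor_measure_def
    by (simp only:) (rule emeasure_PiM_emb, simp_all add: prob_space_measure_pmf)
  also have "\<dots> = (\<Prod>i<l. ennreal (1/2))"
  proof (rule prod.cong)
    show "emeasure ?b {\<tau> i} = ennreal (1/2)" for i
      by (cases "\<tau> i") (simp_all add: emeasure_pmf_single)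
  qed simp
  also have "\<dots> = ennreal (1 / 2 ^ l)"
    by (simp add: power_one_over del: ennreal_half) (simp add: ennreal_power flip: power_one_over del: ennreal_half)
  finally show ?thesis by (rule measure_eq_emeasure_eq_ennreal[rotated]) simp
qed

text \<open>The set splits into cylinders of measure \<open>1 / 2 ^ l\<close>, one for each accepted
  number. Counting them makes the measures of clopen sets computable.\<close>

lemma measure_prefix_num:
  "measure cantor_measure {Y. Q (prefix_num Y l)} = (\<Sum>x<2 ^ l. of_bool (Q (2 ^ l + x))) / 2 ^ l"
proof -
  have eq: "measure cantor_measure {Y. prefix_num Y l = 2 ^ l + x} = 1 / 2 ^ l" if "x < 2 ^ l" for x
    using prefix_num_eq_cylinder[of l "2 ^ l + x"] that measure_cylinder by auto
  have UN: "{Y. Q (prefix_num Y l)} = (\<Union>x\<in>{x\<in>{..<2 ^ l}. Q (2 ^ l + x)}. {Y. prefix_num Y l = 2 ^ l + x})"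
  proof (intro equalityI subsetI)
    fix Y assume "Y \<in> {Y. Q (prefix_num Y l)}"
    then show "Y \<in> (\<Union>x\<in>{x\<in>{..<2 ^ l}. Q (2 ^ l + x)}. {Y. prefix_num Y l = 2 ^ l + x})"
      using prefix_num_ge[of l Y] prefix_num_less[of Y l]
      by (intro UN_I[of "prefix_num Y l - 2 ^ l"]) auto
  qed auto
  have "measure cantor_measure {Y. Q (prefix_num Y l)} =
      (\<Sum>x\<in>{x\<in>{..<2 ^ l}. Q (2 ^ l + x)}. measure cantor_measure {Y. prefix_num Y l = 2 ^ l + x})"
    unfolding UN
  proof (rule cantor.finite_measure_finite_Union)
    have "{Y. prefix_num Y l = v} \<in> sets cantor_measure" for v
      using measurable_sets[OF measurable_prefix_num, of "{v}" l] by (simp add: vimage_def)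
    then show "(\<lambda>x. {Y. prefix_num Y l = 2 ^ l + x}) ` {x\<in>{..<2 ^ l}. Q (2 ^ l + x)} \<subseteq> sets cantor_measure"
      by auto
    show "disjoint_family_on (\<lambda>x. {Y. prefix_num Y l = 2 ^ l + x}) {x\<in>{..<2 ^ l}. Q (2 ^ l + x)}"
      by (simp add: disjoint_family_on_def disjoint_iff)
  qed simp
  also have "\<dots> = (\<Sum>x\<in>{x\<in>{..<2 ^ l}. Q (2 ^ l + x)}. 1 / 2 ^ l)"
    by (intro sum.cong refl eq) simp
  also have "\<dots> = (\<Sum>x<2 ^ l. if Q (2 ^ l + x) then 1 / 2 ^ l else 0)"
    by (rule sum.inter_filter) simp
  also have "\<dots> = (\<Sum>x<2 ^ l. of_bool (Q (2 ^ l + x))) / 2 ^ l"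
    unfolding sum_divide_distrib by (intro sum.cong refl) simp
  finally show ?thesis .
qed

section \<open>String codes and prefixes\<close>

lemma string_code_Suc: "Suc (string_code \<sigma>) = foldl (\<lambda>n b. 2 * n + of_bool b) 1 \<sigma>"
proof -
  have "0 < foldl (\<lambda>n b. 2 * n + of_bool b) (1 :: nat) \<sigma>"
    by (induction \<sigma> rule: rev_induct) auto
  then show ?thesis by (simp add: string_code_def)
qed

lemma string_code_snoc: "Suc (string_code (\<sigma> @ [b])) = 2 * Suc (string_code \<sigma>) + of_bool b"
  unfolding string_code_Suc by simp

lemma initial_segment_iff_prefix_num:
  "initial_segment \<sigma> Y \<longleftrightarrow> prefix_num Y (length \<sigma>) = Suc (string_code \<sigma>)"
proof (induction \<sigma> rule: rev_induct)
  case Nil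
  show ?case by (simp add: initial_segment_def string_code_def)
next
  case (snoc b \<sigma>)
  have "initial_segment (\<sigma> @ [b]) Y \<longleftrightarrow> initial_segment \<sigma> Y \<and> Y (length \<sigma>) = b"
    by (auto simp: initial_segment_def nth_append less_Suc_eq)
  also have "\<dots> \<longleftrightarrow> prefix_num Y (length (\<sigma> @ [b])) = Suc (string_code (\<sigma> @ [b]))"
  proof -
    have "2 * a + of_bool c = 2 * a' + of_bool c' \<longleftrightarrow> a = a' \<and> c = c'" for a a' :: nat and c c'
      by (cases c; cases c'; auto; presburger)
    from this[of "prefix_num Y (length \<sigma>)" "Y (length \<sigma>)" "Suc (string_code \<sigma>)" b]
    show ?thesis unfolding string_code_snoc snoc.IH by (simp only: length_append_singleton prefix_num.simps)
  qed
  finally show ?case .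
qed

lemma string_code_bounds:
  "2 ^ length \<sigma> \<le> Suc (string_code \<sigma>)" "Suc (string_code \<sigma>) < 2 * 2 ^ length \<sigma>"
proof -
  have "initial_segment \<sigma> (\<lambda>i. \<sigma> ! i)" by (simp add: initial_segment_def)
  then have "Suc (string_code \<sigma>) = prefix_num (\<lambda>i. \<sigma> ! i) (length \<sigma>)"
    by (simp add: initial_segment_iff_prefix_num)
  then show "2 ^ length \<sigma> \<le> Suc (string_code \<sigma>)" "Suc (string_code \<sigma>) < 2 * 2 ^ length \<sigma>"
    using prefix_num_ge prefix_num_less by metis+
qed

lemma length_le_string_code: "length \<sigma> \<le> string_code \<sigma>"
  using string_code_bounds(1)[of \<sigma>] less_exp[of "length \<sigma>"] by linarith

text \<open>The intervals from \<open>2 ^ l\<close> up to \<open>2 * 2 ^ l\<close> are disjoint for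
  different \<open>l\<close>, so a code determines the length of its string.\<close>

lemma length_eqI_string_code:
  assumes "2 ^ l \<le> Suc (string_code \<sigma>)" "Suc (string_code \<sigma>) < 2 * 2 ^ l"
  shows "length \<sigma> = l"
proof -
  have "(2::nat) ^ l < 2 ^ Suc (length \<sigma>)" "(2::nat) ^ length \<sigma> < 2 ^ Suc l"
    using assms string_code_bounds[of \<sigma>] by auto
  then have "l < Suc (length \<sigma>)" "length \<sigma> < Suc l"
    by (simp_all only: power_strict_increasing_iff[of 2] one_less_numeral_iff semiring_norm)
  then show ?thesis by simp
qed

lemma string_code_surj:
  assumes "2 ^ l \<le> v" "v < 2 * 2 ^ l"
  obtains \<sigma> where "length \<sigma> = l" "Suc (string_code \<sigma>) = v"
proof -
  obtain Y where Y: "prefix_num Y l = v" using prefix_num_eq_cylinder[OF assms] by blast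
  have "initial_segment (map Y [0..<l]) Y" by (simp add: initial_segment_def)
  then show ?thesis
    using Y that[of "map Y [0..<l]"] by (simp add: initial_segment_iff_prefix_num)
qed

text \<open>Division by \<open>2 ^ d\<close> truncates the prefix to \<open>l - d\<close> bits.
  Codes determine lengths, so only \<open>d = l - length \<sigma>\<close> can meet the equation, and
  the length of \<open>\<sigma>\<close> does not have to be computed.\<close>

lemma initial_segment_iff_div:
  assumes "length \<sigma> \<le> l"
  shows "initial_segment \<sigma> Y \<longleftrightarrow> (\<exists>d<Suc l. prefix_num Y l div 2 ^ d = Suc (string_code \<sigma>))"
proof
  assume "initial_segment \<sigma> Y"
  then have "prefix_num Y l div 2 ^ (l - length \<sigma>) = Suc (string_code \<sigma>)"
    using prefix_num_div[of Y "length \<sigma>" "l - length \<sigma>"] assms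
    by (simp add: initial_segment_iff_prefix_num)
  then show "\<exists>d<Suc l. prefix_num Y l div 2 ^ d = Suc (string_code \<sigma>)"
    by (intro exI[of _ "l - length \<sigma>"]) simp
next
  assume "\<exists>d<Suc l. prefix_num Y l div 2 ^ d = Suc (string_code \<sigma>)"
  then obtain d where d: "d \<le> l" "prefix_num Y l div 2 ^ d = Suc (string_code \<sigma>)"
    using less_Suc_eq_le by blast
  then have eq: "prefix_num Y (l - d) = Suc (string_code \<sigma>)"
    using prefix_num_div[of Y "l - d" d] by simp
  then have "length \<sigma> = l - d"
    using prefix_num_ge[of "l - d" Y] prefix_num_less[of Y "l - d"]
    by (intro length_eqI_string_code) simp_all
  with eq show "initial_segment \<sigma> Y" by (simp add: initial_segment_iff_prefix_num)
qed

lemma sets_initial_segment: "{Y. initial_segment \<sigma> Y} \<in> sets cantor_measure"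
  unfolding initial_segment_iff_prefix_num
  using measurable_sets[OF measurable_prefix_num, of "{Suc (string_code \<sigma>)}" "length \<sigma>"]
  by (simp add: vimage_def)

lemma sets_open_class: "open_class S \<in> sets cantor_measure"
proof -
  have "open_class S = (\<Union>\<sigma>\<in>S. {Y. initial_segment \<sigma> Y})" by (auto simp: open_class_def)
  then show ?thesis using sets_initial_segment by (auto intro!: sets.countable_UN')
qed

subsection \<open>Independence of disjoint blocks of bits\<close>

text \<open>A one-way implication suffices, since agreement on \<open>K\<close> is symmetric in
  \<open>Y\<close> and \<open>Y'\<close>.\<close>

definition depends_on :: "cantor set \<Rightarrow> nat set \<Rightarrow> bool" where
  "depends_on A K \<longleftrightarrow> (\<forall>Y Y'. (\<forall>i\<in>K. Y i = Y' i) \<longrightarrow> Y \<in> A \<longrightarrow> Y' \<in> A)"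

lemma depends_on_iff:
  assumes "depends_on A K" "\<And>i. i \<in> K \<Longrightarrow> Y i = Y' i"
  shows "Y \<in> A \<longleftrightarrow> Y' \<in> A"
  using assms unfolding depends_on_def by metis

lemma depends_on_shift_vimage:
  assumes "depends_on A {..<L}" "{q..<q + L} \<subseteq> K"
  shows "depends_on ((shift ^^ q) -` A) K"
  unfolding depends_on_def
proof (intro allI impI)
  fix Y Y' assume eq: "\<forall>i\<in>K. Y i = Y' i" and Y: "Y \<in> (shift ^^ q) -` A"
  have "\<forall>i\<in>{..<L}. (shift ^^ q) Y i = (shift ^^ q) Y' i"
    using eq assms(2) by (simp add: shift_funpow subset_eq)
  with Y assms(1) show "Y' \<in> (shift ^^ q) -` A"
    unfolding depends_on_def by (metis vimageD vimageI2)
qed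

lemma depends_on_UN:
  assumes "\<And>i. i \<in> I \<Longrightarrow> depends_on (A i) K"
  shows "depends_on (\<Union>i\<in>I. A i) K"
  using assms unfolding depends_on_def by (auto; blast)

text \<open>The coordinates are independent, hence so are their restrictions to disjoint blocks, and
  each \<open>A j\<close> is an event about the restriction to \<open>K j\<close>.\<close>

lemma measure_INT_disjoint_blocks:
  assumes "finite J" "disjoint_family_on K J"
    and A: "\<And>j. j \<in> J \<Longrightarrow> A j \<in> sets cantor_measure" "\<And>j. j \<in> J \<Longrightarrow> depends_on (A j) (K j)"
  shows "measure cantor_measure (\<Inter>j\<in>J. A j) = (\<Prod>j\<in>J. measure cantor_measure (A j))"
proof (cases "J = {}")
  case True
  then show ?thesis using cantor.prob_space by simp
next
  case False
  let ?b = "measure_pmf (bernoulli_pmf (1/2))"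
  let ?X = "\<lambda>j \<omega>. restrict (\<lambda>i. \<omega> i) (K j)"
  have "cantor.indep_vars (\<lambda>_. ?b) (\<lambda>i Y. Y i) UNIV"
  proof (subst cantor.indep_vars_iff_distr_eq_PiM')
    have "distr cantor_measure ?b (\<lambda>Y. Y i) = ?b" for i
      unfolding cantor_measure_def by (intro distr_PiM_component prob_space_measure_pmf) simp
    then show "distr cantor_measure (PiM UNIV (\<lambda>_. ?b)) (\<lambda>Y. \<lambda>i\<in>UNIV. Y i) =
        PiM UNIV (\<lambda>i. distr cantor_measure ?b (\<lambda>Y. Y i))"
      by (simp add: restrict_def distr_id2 flip: cantor_measure_def)
  qed (simp_all add: measurable_cantor_component)
  then have ind: "cantor.indep_vars (\<lambda>j. PiM (K j) (\<lambda>_. ?b)) ?X J"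
    by (rule cantor.indep_vars_restrict) (use assms(2) in auto)
  \<comment> \<open>\<open>B j\<close> reads \<open>A j\<close> off the restriction by extending it
    with \<open>False\<close> outside \<open>K j\<close>; by \<open>depends_on\<close> the choice of
    extension is immaterial.\<close>
  define B where "B j = {g \<in> space (PiM (K j) (\<lambda>_. ?b)). (\<lambda>i. i \<in> K j \<and> g i) \<in> A j}" for j
  have B: "B j \<in> sets (PiM (K j) (\<lambda>_. ?b))" if "j \<in> J" for j
  proof -
    have "(\<lambda>g i. i \<in> K j \<and> g i) \<in> measurable (PiM (K j) (\<lambda>_. ?b)) cantor_measure"
      unfolding cantor_measure_def
    proof (rule measurable_PiM_single')
      fix i
      show "(\<lambda>g. i \<in> K j \<and> g i) \<in> measurable (PiM (K j) (\<lambda>_. ?b)) ?b"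
        using measurable_component_singleton[of i "K j" "\<lambda>_. ?b"] by (cases "i \<in> K j") simp_all
    qed (simp add: PiE_UNIV_domain)
    from measurable_sets[OF this A(1)[OF that]] show ?thesis
      by (simp add: B_def vimage_def Int_def conj_commute)
  qed
  have "?X j -` B j \<inter> space cantor_measure = A j" if "j \<in> J" for j
  proof -
    have "(\<lambda>i. i \<in> K j \<and> restrict Y (K j) i) \<in> A j \<longleftrightarrow> Y \<in> A j" for Y
      by (rule depends_on_iff[OF A(2)[OF that]]) simp
    then show ?thesis by (auto simp: B_def space_PiM)
  qed
  then show ?thesis
    using cantor.indep_varsD_finite[OF ind False assms(1), of B] B by simp
qed

text \<open>Independence is used on two levels. As \<open>L \<le> N \<le> n j\<close>, the window of
  length \<open>L\<close> at \<open>n j * i\<close> ends by \<open>n j * Suc i\<close>, which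
  separates the values of \<open>i\<close>. The factor \<open>Suc k\<close> keeps all windows with
  \<open>1 \<le> i \<le> k\<close> between \<open>n j\<close> and \<open>n (Suc j)\<close>, which
  separates the values of \<open>j\<close>.\<close>

lemma measure_INT_UN_shift:
  fixes k N :: nat
  assumes A: "A \<in> sets cantor_measure" "depends_on A {..<L}" and N: "L \<le> N" "0 < N"
  defines "n \<equiv> \<lambda>j. N * Suc k ^ j"
  shows "measure cantor_measure (\<Inter>j<t. \<Union>i\<in>{1..k}. (shift ^^ (n j * i)) -` A) =
    (1 - (1 - measure cantor_measure A) ^ k) ^ t"
proof -
  let ?V = "\<lambda>j. \<Union>i\<in>{1..k}. (shift ^^ (n j * i)) -` A"
  have nN: "N \<le> n j" for j unfolding n_def by simp
  have block: "{n j * i..<n j * i + L} \<subseteq> {n j * i..<n j * Suc i}" for i j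
    using nN[of j] N(1) by auto
  have A': "- A \<in> sets cantor_measure"
    using sets.compl_sets[OF A(1)] by (simp add: Compl_eq_Diff_UNIV)
  have V_sets: "?V j \<in> sets cantor_measure" for j
    using A(1) by (auto intro!: sets_shift_vimage)
  have V_measure: "measure cantor_measure (?V j) = 1 - (1 - measure cantor_measure A) ^ k" for j
  proof -
    \<comment> \<open>Independence concerns intersections, so the union over \<open>i\<close> is
      measured through its complement.\<close>
    have "measure cantor_measure (\<Inter>i\<in>{1..k}. (shift ^^ (n j * i)) -` (- A)) =
        (\<Prod>i\<in>{1..k}. measure cantor_measure ((shift ^^ (n j * i)) -` (- A)))"
    proof (rule measure_INT_disjoint_blocks[where K = "\<lambda>i. {n j * i..<n j * Suc i}"])
      have "{n j * i..<n j * Suc i} \<inter> {n j * i'..<n j * Suc i'} = {}" if "i < i'" for i i'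
      proof -
        have "n j * Suc i \<le> n j * i'" using that by (intro mult_le_mono2) simp
        then show ?thesis by (auto simp del: mult_Suc_right)
      qed
      then show "disjoint_family_on (\<lambda>i. {n j * i..<n j * Suc i}) {1..k}"
        unfolding disjoint_family_on_def by (metis Int_commute nat_neq_iff)
      have "depends_on (- A) {..<L}" using A(2) unfolding depends_on_def by (metis ComplD ComplI)
      then show "depends_on ((shift ^^ (n j * i)) -` (- A)) {n j * i..<n j * Suc i}" for i
        using block by (rule depends_on_shift_vimage)
      show "(shift ^^ (n j * i)) -` (- A) \<in> sets cantor_measure" for i
        using A' by (rule sets_shift_vimage)
    qed simp
    also have "\<dots> = (1 - measure cantor_measure A) ^ k"
      using cantor.prob_compl[OF A(1)]
      by (simp add: measure_shift_vimage[OF A'] flip: Compl_eq_Diff_UNIV)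
    also have "(\<Inter>i\<in>{1..k}. (shift ^^ (n j * i)) -` (- A)) = UNIV - ?V j" by auto
    finally show ?thesis using cantor.prob_compl[OF V_sets, of j] by simp
  qed
  have "measure cantor_measure (\<Inter>j<t. ?V j) = (\<Prod>j<t. measure cantor_measure (?V j))"
  proof (rule measure_INT_disjoint_blocks[where K = "\<lambda>j. {n j..<n (Suc j)}"])
    have "{n j..<n (Suc j)} \<inter> {n j'..<n (Suc j')} = {}" if "j < j'" for j j'
    proof -
      have "n (Suc j) \<le> n j'" unfolding n_def
        using that by (intro mult_le_mono2 power_increasing) auto
      then show ?thesis by auto
    qed
    then show "disjoint_family_on (\<lambda>j. {n j..<n (Suc j)}) {..<t}"
      unfolding disjoint_family_on_def by (metis Int_commute nat_neq_iff)
    show "depends_on (?V j) {n j..<n (Suc j)}" for j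
    proof -
      have "depends_on ((shift ^^ (n j * i)) -` A) {n j..<n (Suc j)}" if "i \<in> {1..k}" for i
      proof (rule depends_on_shift_vimage[OF A(2)])
        have "n j * Suc i \<le> n j * Suc k" "n j * 1 \<le> n j * i"
          using that by (intro mult_le_mono2; simp)+
        then have "{n j * i..<n j * Suc i} \<subseteq> {n j..<n (Suc j)}"
          by (auto simp: n_def simp del: mult_Suc_right simp: mult.assoc mult.commute mult.left_commute)
        with block show "{n j * i..<n j * i + L} \<subseteq> {n j..<n (Suc j)}" by blast
      qed
      then show ?thesis by (rule depends_on_UN)
    qed
    show "?V j \<in> sets cantor_measure" for j by (rule V_sets)
  qed simp
  then show ?thesis by (simp only: V_measure prod_constant card_lessThan)
qed

subsection \<open>Schnorr tests from computable clopen approximations\<close>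

text \<open>A search over \<open>r\<close> for strings of length \<open>l m r\<close> accepted by
  \<open>E\<close> enumerates \<open>W m\<close>; counting the accepted strings at index
  \<open>g m n\<close> approximates its measure to within \<open>1 / 2 ^ n\<close>.\<close>

lemma Schnorr_test_clopen_approximation:
  fixes E :: "nat \<Rightarrow> nat \<Rightarrow> nat \<Rightarrow> bool" and l g :: "nat \<Rightarrow> nat \<Rightarrow> nat"
  assumes E: "recursive_pred 3 (\<lambda>xs. E (hd xs) (hd (tl xs)) (hd (tl (tl xs))))"
    and l: "recursive_fun 2 (\<lambda>xs. l (hd xs) (hd (tl xs)))"
    and g: "recursive_fun 2 (\<lambda>xs. g (hd xs) (hd (tl xs)))"
    and W: "\<And>m. W m = (\<Union>r. {Y. E m r (prefix_num Y (l m r))})"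
    and small: "\<And>m. measure cantor_measure (W m) \<le> 1 / 2 ^ m"
    and approx: "\<And>m n. measure cantor_measure (W m) -
      measure cantor_measure {Y. E m (g m n) (prefix_num Y (l m (g m n)))} \<le> 1 / 2 ^ n"
  shows "Schnorr_test W"
proof -
  define S where "S m = {\<sigma>. \<exists>r. length \<sigma> = l m r \<and> E m r (Suc (string_code \<sigma>))}" for m
  have W_open: "W m = open_class (S m)" for m
  proof (intro equalityI subsetI)
    fix Y assume "Y \<in> W m"
    then obtain r where r: "E m r (prefix_num Y (l m r))" using W by auto
    have seg: "initial_segment (map Y [0..<l m r]) Y" by (simp add: initial_segment_def)
    with r have "map Y [0..<l m r] \<in> S m"
      unfolding S_def by (auto simp: initial_segment_iff_prefix_num)
    with seg show "Y \<in> open_class (S m)" unfolding open_class_def by blast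
  next
    fix Y assume "Y \<in> open_class (S m)"
    then show "Y \<in> W m"
      unfolding W open_class_def S_def by (auto simp: initial_segment_iff_prefix_num) metis
  qed
  \<comment> \<open>The two bounds on \<open>Suc y\<close> say that the string coded by
    \<open>y\<close> has length \<open>l m r\<close>.\<close>
  have "ce_set {prod_encode (m, y) | m y. \<exists>r. 2 ^ l m r \<le> Suc y \<and> Suc y < 2 * 2 ^ l m r \<and> E m r (Suc y)}"
    by (rule ce_set_projection, unfold numeral_3_eq_3)
      (intro recursive_intros recursive_fun_comp2[OF l] recursive_pred_comp3[OF E])
  also have "{prod_encode (m, y) | m y. \<exists>r. 2 ^ l m r \<le> Suc y \<and> Suc y < 2 * 2 ^ l m r \<and> E m r (Suc y)} =
      {prod_encode (m, string_code \<sigma>) | m \<sigma>. \<sigma> \<in> S m}" (is "?L = ?R")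
  proof (intro equalityI subsetI)
    fix z assume "z \<in> ?L"
    then obtain m y r where *: "z = prod_encode (m, y)" "2 ^ l m r \<le> Suc y" "Suc y < 2 * 2 ^ l m r"
      "E m r (Suc y)" by blast
    obtain \<sigma> where "length \<sigma> = l m r" "Suc (string_code \<sigma>) = Suc y"
      using string_code_surj[OF *(2,3)] by blast
    with * have "\<sigma> \<in> S m" "z = prod_encode (m, string_code \<sigma>)" unfolding S_def by auto
    then show "z \<in> ?R" by blast
  next
    fix z assume "z \<in> ?R"
    then obtain m \<sigma> r where *: "z = prod_encode (m, string_code \<sigma>)" "length \<sigma> = l m r"
      "E m r (Suc (string_code \<sigma>))" unfolding S_def by blast
    then show "z \<in> ?L" using string_code_bounds[of \<sigma>] by auto
  qed
  finally have "uniformly_Sigma01 W"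
    unfolding uniformly_Sigma01_def uniformly_ce_strings_def using W_open by blast
  moreover have "uniformly_computable_reals (\<lambda>m. measure cantor_measure (W m))"
  proof -
    define a where "a m n = (\<Sum>x<2 ^ l m (g m n). of_bool (E m (g m n) (2 ^ l m (g m n) + x)) :: nat)"
      for m n :: nat
    \<comment> \<open>One less than the denominator \<open>2 ^ l m (g m n)\<close>, because
      approximations are divided by \<open>Suc (c m n)\<close>.\<close>
    define c where "c m n = (2 ^ l m (g m n) - 1 :: nat)" for m n
    have "computable2 a"
      unfolding a_def by (rule computable2I, unfold numeral_2_eq_2)
        (intro recursive_intros recursive_fun_comp2[OF l] recursive_fun_comp2[OF g]
          recursive_pred_comp3[OF E])
    moreover have "computable2 c"
      unfolding c_def by (rule computable2I, unfold numeral_2_eq_2)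
        (intro recursive_intros recursive_fun_comp2[OF l] recursive_fun_comp2[OF g])
    moreover have "computable2 (\<lambda>_ _. 0)"
      by (rule computable2I) (rule recursive_fun_const)
    moreover have "\<bar>measure cantor_measure (W m) - (real (a m n) - real 0) / real (Suc (c m n))\<bar> \<le> 1 / 2 ^ n"
      for m n
    proof -
      let ?A = "{Y. E m (g m n) (prefix_num Y (l m (g m n)))}"
      have "(real (a m n) - real 0) / real (Suc (c m n)) = measure cantor_measure ?A"
        unfolding measure_prefix_num a_def c_def by simp
      moreover have "measure cantor_measure ?A \<le> measure cantor_measure (W m)"
      proof (rule cantor.finite_measure_mono)
        show "?A \<subseteq> W m" unfolding W by blast
        show "W m \<in> sets cantor_measure" unfolding W_open by (rule sets_open_class)
      qed
      ultimately show ?thesis using approx[of m n] by simp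
    qed
    ultimately show ?thesis
      unfolding uniformly_computable_reals_def
      by (intro exI[of _ a] exI[of _ "\<lambda>_ _. 0"] exI[of _ c]) simp
  qed
  ultimately show ?thesis unfolding Schnorr_test_def using small by blast
qed

text \<open>A point lost when \<open>B\<close> shrinks to \<open>A\<close> is sent into
  \<open>B - A\<close> by one of the \<open>t * k\<close> shifts. Each shift preserves the measure,
  so the union bound applies.\<close>

lemma measure_INT_UN_shift_diff:
  assumes "A \<in> sets cantor_measure" "B \<in> sets cantor_measure" "A \<subseteq> B"
  shows "measure cantor_measure (\<Inter>j<t. \<Union>i\<in>{1..k}. (shift ^^ q j i) -` B) -
      measure cantor_measure (\<Inter>j<t. \<Union>i\<in>{1..k}. (shift ^^ q j i) -` A)
    \<le> real (t * k) * (measure cantor_measure B - measure cantor_measure A)"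
proof (cases "t = 0")
  \<comment> \<open>For \<open>t = 0\<close> both intersections are the whole space and the
    difference vanishes.\<close>
  case False
  let ?W = "\<lambda>B. \<Inter>j<t. \<Union>i\<in>{1..k}. (shift ^^ q j i) -` B"
  let ?D = "\<lambda>j i. (shift ^^ q j i) -` (B - A)"
  have W_sets: "?W C \<in> sets cantor_measure" if "C \<in> sets cantor_measure" for C
    using that False by (intro sets.countable_INT' sets.finite_UN) (auto intro: sets_shift_vimage)
  have D_sets: "?D j i \<in> sets cantor_measure" for j i
    using assms by (intro sets_shift_vimage) auto
  have DU_sets: "(\<Union>(j, i)\<in>{..<t} \<times> {1..k}. ?D j i) \<in> sets cantor_measure"
    unfolding case_prod_beta by (intro sets.finite_UN D_sets) simp
  have "?W B \<subseteq> ?W A \<union> (\<Union>(j, i)\<in>{..<t} \<times> {1..k}. ?D j i)" by fastforce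
  then have "measure cantor_measure (?W B) \<le> measure cantor_measure (?W A \<union> (\<Union>(j, i)\<in>{..<t} \<times> {1..k}. ?D j i))"
    by (intro cantor.finite_measure_mono sets.Un W_sets assms(1) DU_sets)
  also have "\<dots> \<le> measure cantor_measure (?W A) + measure cantor_measure (\<Union>(j, i)\<in>{..<t} \<times> {1..k}. ?D j i)"
    by (intro measure_Un_le W_sets assms(1) DU_sets)
  also have "measure cantor_measure (\<Union>(j, i)\<in>{..<t} \<times> {1..k}. ?D j i) \<le>
      (\<Sum>(j, i)\<in>{..<t} \<times> {1..k}. measure cantor_measure (?D j i))"
    unfolding case_prod_beta by (intro measure_UNION_le D_sets) simp
  also have "\<dots> = (\<Sum>(j, i)\<in>{..<t} \<times> {1..k}. measure cantor_measure (B - A))"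
    using assms by (simp add: measure_shift_vimage)
  also have "\<dots> = real (t * k) * (measure cantor_measure B - measure cantor_measure A)"
    using cantor.finite_measure_Diff[OF assms(2,1,3)] by simp
  finally show ?thesis by simp
qed simp

subsection \<open>Enumerated open sets\<close>

locale enumerated_open =
  fixes f :: "nat \<Rightarrow> nat" and S :: "bool list set"
  assumes f: "computable f" and range_f: "string_code ` S = range f"
begin

definition stage :: "nat \<Rightarrow> cantor set" where
  "stage s = open_class {\<sigma> \<in> S. \<exists>i<s. string_code \<sigma> = f i}"

text \<open>A computable bound on the length of each string enumerated before stage
  \<open>s\<close>, because a string is no longer than its code. A sum replaces the maximum since
  sums are known to be recursive.\<close>

definition len :: "nat \<Rightarrow> nat" where
  "len s = (\<Sum>i<s. f i)"

text \<open>Decidable form of membership in \<open>stage s\<close>: when \<open>v\<close> is the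
  number of a prefix of length \<open>l \<ge> len s\<close>, some truncation of that prefix has been
  enumerated.\<close>

definition hit :: "nat \<Rightarrow> nat \<Rightarrow> nat \<Rightarrow> bool" where
  "hit s l v \<longleftrightarrow> (\<exists>i<s. \<exists>d<Suc l. v div 2 ^ d = Suc (f i))"

lemma stage_iff_hit:
  assumes "len s \<le> l"
  shows "Y \<in> stage s \<longleftrightarrow> hit s l (prefix_num Y l)"
proof -
  have short: "length \<sigma> \<le> l" if "i < s" "string_code \<sigma> = f i" for i \<sigma>
  proof -
    have "f i \<le> len s" unfolding len_def using that(1) by (intro member_le_sum) auto
    then show ?thesis using length_le_string_code[of \<sigma>] that(2) assms by linarith
  qed
  have "Y \<in> stage s \<longleftrightarrow> (\<exists>i<s. \<exists>\<sigma>\<in>S. string_code \<sigma> = f i \<and> initial_segment \<sigma> Y)"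
    unfolding stage_def open_class_def by blast
  also have "\<dots> \<longleftrightarrow> (\<exists>i<s. \<exists>\<sigma>\<in>S. string_code \<sigma> = f i \<and> (\<exists>d<Suc l. prefix_num Y l div 2 ^ d = Suc (f i)))"
    using short initial_segment_iff_div by metis
  also have "\<dots> \<longleftrightarrow> hit s l (prefix_num Y l)"
  proof -
    have "\<exists>\<sigma>\<in>S. string_code \<sigma> = f i" for i
      using rangeI[of f i] unfolding range_f[symmetric] by auto
    then show ?thesis unfolding hit_def by blast
  qed
  finally show ?thesis .
qed

text \<open>The bits from position \<open>q\<close> on are recovered from the unshifted prefix
  number, so a single long prefix of \<open>Y\<close> decides many shifts at once.\<close>

lemma shift_stage_iff_hit:
  assumes "q + len s \<le> l"
  shows "(shift ^^ q) Y \<in> stage s \<longleftrightarrow> hit s (l - q) (2 ^ (l - q) + prefix_num Y l mod 2 ^ (l - q))"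
proof -
  have "len s \<le> l - q" "q + (l - q) = l" using assms by simp_all
  then show ?thesis using stage_iff_hit[of s "l - q"] prefix_num_shift[of q Y "l - q"] by simp
qed

lemma recursive_len: "recursive_fun n a \<Longrightarrow> recursive_fun n (\<lambda>xs. len (a xs))"
  unfolding len_def by (intro recursive_intros recursive_fun_computable[OF f])

lemma recursive_hit:
  "recursive_fun n a \<Longrightarrow> recursive_fun n b \<Longrightarrow> recursive_fun n c
    \<Longrightarrow> recursive_pred n (\<lambda>xs. hit (a xs) (b xs) (c xs))"
proof (rule recursive_pred_comp3)
  show "recursive_pred 3 (\<lambda>xs. hit (hd xs) (hd (tl xs)) (hd (tl (tl xs))))"
    unfolding hit_def numeral_3_eq_3 by (intro recursive_intros recursive_fun_computable[OF f])
qed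

lemma sets_stage: "stage s \<in> sets cantor_measure"
  unfolding stage_def by (rule sets_open_class)

lemma stage_mono:
  assumes "s \<le> s'"
  shows "stage s \<subseteq> stage s'"
proof -
  have "{\<sigma> \<in> S. \<exists>i<s. string_code \<sigma> = f i} \<subseteq> {\<sigma> \<in> S. \<exists>i<s'. string_code \<sigma> = f i}"
    using assms by (auto intro: less_le_trans)
  then show ?thesis unfolding stage_def open_class_def by blast
qed

lemma UN_stage: "(\<Union>s. stage s) = open_class S"
proof -
  have "\<exists>s. \<exists>i<s. string_code \<sigma> = f i" if "\<sigma> \<in> S" for \<sigma>
    using that range_f by (metis imageE imageI lessI)
  then show ?thesis unfolding stage_def open_class_def by blast
qed

lemma depends_on_stage: "depends_on (stage s) {..<len s}"
  unfolding depends_on_def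
proof (intro allI impI)
  fix Y Y' :: cantor
  assume "\<forall>i\<in>{..<len s}. Y i = Y' i" and Y: "Y \<in> stage s"
  then have "prefix_num Y (len s) = prefix_num Y' (len s)" by (intro prefix_num_cong) auto
  with Y show "Y' \<in> stage s" by (simp add: stage_iff_hit[OF order_refl])
qed

section \<open>Effective convergence of the measures of the stages\<close>

lemma measure_stage_le: "measure cantor_measure (stage s) \<le> measure cantor_measure (open_class S)"
  by (rule cantor.finite_measure_mono) (use UN_stage sets_open_class in auto)

text \<open>Search for the first stage whose measure exceeds the given approximation of the limit
  minus \<open>2 / 2 ^ N\<close>. This threshold lies at least \<open>1 / 2 ^ N\<close> and at most
  \<open>3 / 2 ^ N\<close> below the limit, so the search ends and its result is accurate
  enough.\<close>

lemma computable_modulus: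
  assumes "computable_real (1 - measure cantor_measure (open_class S))"
  shows "\<exists>h. computable h \<and> (\<forall>N. measure cantor_measure (open_class S) -
    measure cantor_measure (stage (h N)) \<le> 3 / 2 ^ N)"
proof -
  let ?u = "measure cantor_measure (open_class S)"
  obtain a b c where abc: "computable a" "computable b" "computable c"
    and approx: "\<And>N. \<bar>1 - ?u - (real (a N) - real (b N)) / real (Suc (c N))\<bar> \<le> 1 / 2 ^ N"
    using assms unfolding computable_real_def by blast
  define cnt where "cnt s = (\<Sum>x<2 ^ len s. of_bool (hit s (len s) (2 ^ len s + x)) :: nat)" for s
  have cnt: "measure cantor_measure (stage s) = real (cnt s) / 2 ^ len s" for s
  proof -
    have "stage s = {Y. hit s (len s) (prefix_num Y (len s))}"
      using stage_iff_hit[OF order_refl] by blast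
    then show ?thesis by (simp add: measure_prefix_num cnt_def)
  qed
  \<comment> \<open>The inequality of \<open>close_iff\<close> multiplied by all denominators, with
    subtracted terms moved across, so that it becomes a decidable relation between natural
    numbers.\<close>
  define close where "close N s \<longleftrightarrow> 2 ^ len s * 2 ^ N * Suc (c N) + b N * 2 ^ len s * 2 ^ N
    < cnt s * Suc (c N) * 2 ^ N + a N * 2 ^ len s * 2 ^ N + 2 * 2 ^ len s * Suc (c N)" for N s
  have close_iff: "close N s \<longleftrightarrow>
      1 - (real (a N) - real (b N)) / real (Suc (c N)) - 2 / 2 ^ N < measure cantor_measure (stage s)" for N s
  proof -
    have *: "L * M * C + B * L * M < n * C * M + A * L * M + 2 * L * C \<longleftrightarrow>
        1 - (A - B) / C - 2 / M < n / L" if "L > 0" "M > 0" "C > 0" for L M C A B n :: real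
      using that by (simp add: field_simps)
    have "close N s \<longleftrightarrow> real (2 ^ len s * 2 ^ N * Suc (c N) + b N * 2 ^ len s * 2 ^ N)
      < real (cnt s * Suc (c N) * 2 ^ N + a N * 2 ^ len s * 2 ^ N + 2 * 2 ^ len s * Suc (c N))"
      unfolding close_def of_nat_less_iff ..
    then show ?thesis
      using *[of "2 ^ len s" "2 ^ N" "real (Suc (c N))" "real (b N)" "real (cnt s)" "real (a N)"]
      by (simp only: cnt of_nat_add of_nat_mult of_nat_power of_nat_numeral) simp
  qed
  have ex: "\<exists>s. close N s" for N
  proof -
    have "(\<lambda>s. measure cantor_measure (stage s)) \<longlonglongrightarrow> measure cantor_measure (\<Union>s. stage s)"
      by (rule cantor.finite_Lim_measure_incseq) (auto simp: sets_stage incseq_def dest: stage_mono)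
    moreover have "1 - (real (a N) - real (b N)) / real (Suc (c N)) - 2 / 2 ^ N < ?u"
    proof -
      have "2 / 2 ^ N = 1 / 2 ^ N + 1 / (2 ^ N :: real)" "0 < 1 / (2 ^ N :: real)" by simp_all
      with approx[of N] show ?thesis by linarith
    qed
    ultimately have "\<forall>\<^sub>F s in sequentially. 1 - (real (a N) - real (b N)) / real (Suc (c N)) - 2 / 2 ^ N
        < measure cantor_measure (stage s)"
      by (intro order_tendstoD(1)) (simp_all add: UN_stage)
    then show ?thesis unfolding close_iff by (auto dest: eventually_happens)
  qed
  define h where "h N = (LEAST s. close N s)" for N
  have "recursive_fun 1 (\<lambda>xs. h (hd xs))"
    unfolding h_def close_def cnt_def One_nat_def
    by (rule recursive_fun_Least)
      (intro recursive_intros recursive_fun_computable[OF abc(1)] recursive_fun_computable[OF abc(2)]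
        recursive_fun_computable[OF abc(3)] recursive_len recursive_hit,
        use ex in \<open>simp add: close_def cnt_def\<close>)
  then have "computable h" by (rule computableI)
  moreover have "?u - measure cantor_measure (stage (h N)) \<le> 3 / 2 ^ N" for N
  proof -
    have "close N (h N)" unfolding h_def using ex by (rule LeastI_ex)
    then have "1 - (real (a N) - real (b N)) / real (Suc (c N)) - 2 / 2 ^ N
        < measure cantor_measure (stage (h N))" by (simp only: close_iff)
    moreover have "3 / 2 ^ N = 1 / 2 ^ N + 2 / (2 ^ N :: real)" by (simp flip: add_divide_distrib)
    ultimately show ?thesis using approx[of N] by linarith
  qed
  ultimately show ?thesis by blast
qed

text \<open>For each \<open>m\<close> the times \<open>n m j\<close> are spaced for one stage
  \<open>s m\<close>, where independence bounds the measure. The stages that approximate the measure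
  keep these times; for them only closeness to the full open class is used.\<close>

lemma Schnorr_test_not_recurrent:
  assumes u: "measure cantor_measure (open_class S) < 1"
    and comp: "computable_real (1 - measure cantor_measure (open_class S))"
  shows "\<exists>(t :: nat \<Rightarrow> nat) n. (\<forall>m j. n m j \<ge> 1) \<and>
    Schnorr_test (\<lambda>m. \<Inter>j<t m. \<Union>i\<in>{1..k}. (shift ^^ (n m j * i)) -` open_class S)"
proof -
  let ?u = "measure cantor_measure (open_class S)"
  obtain h where h: "computable h" "\<And>N. ?u - measure cantor_measure (stage (h N)) \<le> 3 / 2 ^ N"
    using computable_modulus[OF comp] by blast
  \<comment> \<open>Such a \<open>c\<close> exists because \<open>?u < 1\<close> makes the base
    smaller than 1. It enters the recursive functions as a constant, so its existence is
    enough.\<close>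
  obtain c where c: "(1 - (1 - ?u) ^ k) ^ c < 1 / 2"
  proof -
    have "0 < (1 - ?u) ^ k" "(1 - ?u) ^ k \<le> 1" using u by (auto intro: power_le_one)
    then show thesis using real_arch_pow_inv[of "1/2" "1 - (1 - ?u) ^ k"] that by auto
  qed
  define t where "t m = c * Suc m" for m
  \<comment> \<open>With \<open>x = 3 * (t m * k)\<close>, the error of the \<open>t m * k\<close>
    shifts is at most \<open>x / 2 ^ (Suc m + x)\<close>; as \<open>x \<le> 2 ^ x\<close>, this
    leaves \<open>1 / 2 ^ Suc m\<close>.\<close>
  define s where "s m = h (Suc m + 3 * (t m * k))" for m
  define n where "n m j = Suc (len (s m)) * Suc k ^ j" for m j
  \<comment> \<open>Every shift \<open>n m j * i\<close> with \<open>j < t m\<close> and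
    \<open>i \<le> k\<close> is at most \<open>n m (t m)\<close>, so this many bits contain all
    windows of length \<open>len r\<close>.\<close>
  define l where "l m r = n m (t m) + len r" for m r
  \<comment> \<open>Bounded quantifiers start at 0, so \<open>Suc i\<close> with
    \<open>i < k\<close> stands for the indices 1 to \<open>k\<close>.\<close>
  define E where "E m r v \<longleftrightarrow> (\<forall>j<t m. \<exists>i<k. hit r (l m r - n m j * Suc i)
    (2 ^ (l m r - n m j * Suc i) + v mod 2 ^ (l m r - n m j * Suc i)))" for m r v
  define g where "g m e = h (e + 3 * (t m * k))" for m e
  define W where "W B m = (\<Inter>j<t m. \<Union>i\<in>{1..k}. (shift ^^ (n m j * i)) -` B)" for B m
  have W_diff: "measure cantor_measure (W (open_class S) m) -
      measure cantor_measure (W (stage (h (e + 3 * (t m * k)))) m) \<le> 1 / 2 ^ e" for m e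
  proof -
    let ?x = "t m * k" and ?r = "h (e + 3 * (t m * k))"
    have "measure cantor_measure (W (open_class S) m) - measure cantor_measure (W (stage ?r) m)
        \<le> real ?x * (?u - measure cantor_measure (stage ?r))"
      unfolding W_def
      by (rule measure_INT_UN_shift_diff) (use UN_stage in \<open>auto simp: sets_stage sets_open_class\<close>)
    also have "\<dots> \<le> real ?x * (3 / 2 ^ (e + 3 * ?x))"
      by (intro mult_left_mono h(2)) simp
    also have "\<dots> = real (3 * ?x) / 2 ^ (3 * ?x) * (1 / 2 ^ e)"
      by (simp add: power_add mult_ac)
    also have "\<dots> \<le> 1 * (1 / 2 ^ e)"
    proof (rule mult_right_mono)
      have "real (3 * ?x) < 2 ^ (3 * ?x)" by (rule of_nat_less_two_power)
      then show "real (3 * ?x) / 2 ^ (3 * ?x) \<le> 1" by (simp add: divide_le_eq)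
    qed simp
    finally show ?thesis by simp
  qed
  have W_stage: "W (stage r) m = {Y. E m r (prefix_num Y (l m r))}" for m r
  proof -
    have hit_iff: "(shift ^^ (n m j * Suc i)) Y \<in> stage r \<longleftrightarrow> hit r (l m r - n m j * Suc i)
      (2 ^ (l m r - n m j * Suc i) + prefix_num Y (l m r) mod 2 ^ (l m r - n m j * Suc i))"
      if "j < t m" "i < k" for i j Y
    proof (rule shift_stage_iff_hit)
      have "n m j * Suc i \<le> n m j * Suc k" using that(2) by (intro mult_le_mono2) simp
      also have "\<dots> = n m (Suc j)" unfolding n_def by (simp only: power_Suc mult_ac)
      also have "\<dots> \<le> n m (t m)"
        unfolding n_def using that(1) by (intro mult_le_mono2 power_increasing) auto
      finally show "n m j * Suc i + len r \<le> l m r" unfolding l_def by simp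
    qed
    have "{1..k} = Suc ` {..<k}" by (simp only: lessThan_atLeast0 image_Suc_atLeastLessThan) auto
    then have "Y \<in> W (stage r) m \<longleftrightarrow> (\<forall>j<t m. \<exists>i<k. (shift ^^ (n m j * Suc i)) Y \<in> stage r)" for Y
      unfolding W_def by (simp del: mult_Suc_right funpow.simps) blast
    also have "\<dots> Y \<longleftrightarrow> E m r (prefix_num Y (l m r))" for Y
      unfolding E_def using hit_iff by (simp del: mult_Suc_right funpow.simps cong: conj_cong)
    finally show ?thesis by blast
  qed
  have test: "Schnorr_test (W (open_class S))"
  proof (rule Schnorr_test_clopen_approximation)
    note rec = recursive_intros recursive_fun_computable[OF h(1)] recursive_len
    show "recursive_fun 2 (\<lambda>xs. l (hd xs) (hd (tl xs)))"
      unfolding l_def n_def t_def s_def numeral_2_eq_2 by (intro rec)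
    show "recursive_fun 2 (\<lambda>xs. g (hd xs) (hd (tl xs)))"
      unfolding g_def t_def numeral_2_eq_2 by (intro rec)
    show "recursive_pred 3 (\<lambda>xs. E (hd xs) (hd (tl xs)) (hd (tl (tl xs))))"
      unfolding E_def l_def n_def t_def s_def numeral_3_eq_3 by (intro rec recursive_hit)
    show "W (open_class S) m = (\<Union>r. {Y. E m r (prefix_num Y (l m r))})" for m
    proof -
      have "Y \<in> W (open_class S) m \<longleftrightarrow> (\<exists>r. Y \<in> W (stage r) m)" for Y
      proof
        assume "Y \<in> W (open_class S) m"
        then have "\<forall>j<t m. \<exists>i\<in>{1..k}. \<exists>r. (shift ^^ (n m j * i)) Y \<in> stage r"
          unfolding W_def UN_stage[symmetric] by blast
        then have "\<forall>j<t m. \<exists>r. \<exists>i\<in>{1..k}. (shift ^^ (n m j * i)) Y \<in> stage r" by blast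
        then obtain R where R: "\<And>j. j < t m \<Longrightarrow> \<exists>i\<in>{1..k}. (shift ^^ (n m j * i)) Y \<in> stage (R j)"
          by metis
        \<comment> \<open>The sum of the finitely many witnessing stages bounds each of them, so by
          monotonicity it serves all \<open>j\<close> at once.\<close>
        have "stage (R j) \<subseteq> stage (\<Sum>j<t m. R j)" if "j < t m" for j
          using that by (intro stage_mono member_le_sum) auto
        with R have "Y \<in> W (stage (\<Sum>j<t m. R j)) m" unfolding W_def by blast
        then show "\<exists>r. Y \<in> W (stage r) m" ..
      next
        assume "\<exists>r. Y \<in> W (stage r) m"
        then show "Y \<in> W (open_class S) m" unfolding W_def UN_stage[symmetric] by blast
      qed
      then show ?thesis unfolding W_stage by blast
    qed
    show "measure cantor_measure (W (open_class S) m) \<le> 1 / 2 ^ m" for m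
    proof -
      \<comment> \<open>The bound is split into two halves \<open>1 / 2 ^ Suc m\<close>: one from
        independence at stage \<open>s m\<close>, the other from passing to the full open
        class.\<close>
      let ?v = "measure cantor_measure (stage (s m))"
      have "measure cantor_measure (W (stage (s m)) m) = (1 - (1 - ?v) ^ k) ^ t m"
        unfolding W_def n_def
        by (rule measure_INT_UN_shift[OF sets_stage depends_on_stage]) auto
      also have "\<dots> \<le> (1 - (1 - ?u) ^ k) ^ t m"
        using measure_stage_le[of "s m"] u
        by (intro power_mono diff_left_mono) (auto intro: power_le_one)
      also have "\<dots> = ((1 - (1 - ?u) ^ k) ^ c) ^ Suc m"
        unfolding t_def by (rule power_mult)
      also have "\<dots> \<le> (1 / 2) ^ Suc m"
        using c u by (intro power_mono zero_le_power) (auto intro: power_le_one)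
      also have "\<dots> = 1 / 2 ^ Suc m" by (rule power_one_over)
      finally have "measure cantor_measure (W (stage (s m)) m) \<le> 1 / 2 ^ Suc m" .
      moreover have "measure cantor_measure (W (open_class S) m) -
          measure cantor_measure (W (stage (s m)) m) \<le> 1 / 2 ^ Suc m"
        unfolding s_def by (rule W_diff)
      moreover have "1 / 2 ^ Suc m + 1 / 2 ^ Suc m = 1 / (2 ^ m :: real)" by simp
      ultimately show ?thesis by linarith
    qed
    show "measure cantor_measure (W (open_class S) m) -
      measure cantor_measure {Y. E m (g m e) (prefix_num Y (l m (g m e)))} \<le> 1 / 2 ^ e" for m e
      unfolding W_stage[symmetric] unfolding g_def by (rule W_diff)
  qed
  show ?thesis
  proof (intro exI[of _ t] exI[of _ n] conjI allI)
    show "n m j \<ge> 1" for m j unfolding n_def by (simp add: Suc_le_eq)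
    show "Schnorr_test (\<lambda>m. \<Inter>j<t m. \<Union>i\<in>{1..k}. (shift ^^ (n m j * i)) -` open_class S)"
      using test unfolding W_def .
  qed
qed

end

section \<open>Recurrence of Schnorr random sequences\<close>

theorem theorem4p1:
  fixes P :: "cantor set" and Z :: cantor
  assumes "Pi01_class P"
    and "measure cantor_measure P > 0"
    and "computable_real (measure cantor_measure P)"
    and "Schnorr_random Z"
  shows "multiply_recurrent P Z"
proof -
  obtain S where S: "ce_strings S" "- P = open_class S"
    using assms(1) unfolding Pi01_class_def Sigma01_class_def by blast
  show ?thesis
  proof (cases "S = {}")
    \<comment> \<open>The empty set is not the range of a function; here \<open>P\<close> is the
      whole space and any time serves.\<close>
    case True
    then have "P = UNIV" using S(2) by (auto simp: open_class_def)
    then show ?thesis unfolding multiply_recurrent_def k_recurrent_def by auto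
  next
    case False
    then obtain f where f: "computable f" "string_code ` S = range f"
      using S(1) unfolding ce_strings_def ce_set_def by auto
    interpret enumerated_open f S by standard (fact f)+
    have "P = UNIV - open_class S" using S(2) by auto
    then have P: "measure cantor_measure P = 1 - measure cantor_measure (open_class S)"
      using cantor.prob_compl[OF sets_open_class[of S]] by simp
    have "k_recurrent k P Z" for k
    proof -
      obtain t :: "nat \<Rightarrow> nat" and n where n: "\<And>m j. n m j \<ge> 1"
        and "Schnorr_test (\<lambda>m. \<Inter>j<t m. \<Union>i\<in>{1..k}. (shift ^^ (n m j * i)) -` open_class S)"
        using Schnorr_test_not_recurrent[of k] assms(2,3) unfolding P by auto
      then have "Z \<notin> (\<Inter>m. \<Inter>j<t m. \<Union>i\<in>{1..k}. (shift ^^ (n m j * i)) -` open_class S)"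
        using assms(4) unfolding Schnorr_random_def by blast
      \<comment> \<open>Leaving the test at \<open>m\<close> means that for some \<open>j\<close>
        every shift avoids the complement of \<open>P\<close>; then \<open>n m j\<close> is the time
        of recurrence.\<close>
      then obtain m j where "\<forall>i\<in>{1..k}. (shift ^^ (n m j * i)) Z \<notin> open_class S" by blast
      then have "Z \<in> (\<Inter>i\<in>{1..k}. (shift ^^ (n m j * i)) -` P)" using S(2) by blast
      with n[of m j] show ?thesis unfolding k_recurrent_def by blast
    qed
    then show ?thesis unfolding multiply_recurrent_def by blast
  qed
qed

end
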